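(* There exist absolute constants $c,C>0$ such that for arbitrarily large $n$ there exist an $n$-element set $\mathcal{A}$ of real numbers and a graph $G_n$ with vertex set $\mathcal{A}$ having at least $c\,n^{3/2}$ edges such that $$|\mathcal{A}+_{G_n}\mathcal{A}|+|\mathcal{A}/_{G_n}\mathcal{A}|\le C|\mathcal{A}|.$$
   Context: For a graph $G$ whose vertices are the elements of a set $\mathcal{A}$ of reals, $\mathcal{A}+_{G}\mathcal{A}=\{a+b:\{a,b\}\in E(G)\}$ and $\mathcal{A}/_{G}\mathcal{A}=\{a/b:\{a,b\}\in E(G)\}$, where each edge $\{a,b\}$ contributes both ratios $a/b$ and $b/a$. *)

theory Defs
  imports Complex_Main
begin

definition simple_graph :: "'a set \<Rightarrow> 'a set set \<Rightarrow> bool" where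
  "simple_graph V E \<longleftrightarrow> finite V \<and> (\<forall>e\<in>E. e \<subseteq> V \<and> card e = 2)"

definition graph_sumset :: "real set set \<Rightarrow> real set" where
  "graph_sumset E = {a + b | a b. {a, b} \<in> E}"

(* Since {a, b} = {b, a}, every edge contributes both a / b and b / a. These are
   genuine ratios only when no edge contains 0. *)
definition graph_ratioset :: "real set set \<Rightarrow> real set" where
  "graph_ratioset E = {a / b | a b. {a, b} \<in> E}"

end

theory Submission
  imports Defs
begin

text \<open>
  Fix \<open>m \<ge> 2\<close> and take for \<open>\<A>\<close> the \<open>m\<^sup>2\<close> numbers \<open>(m + 1)\<^sup>k i\<close> with \<open>0 \<le> k < m\<close> and
  \<open>1 \<le> i \<le> m\<close>; they are pairwise distinct because each has a single nonzero digit in base \<open>m + 1\<close>.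
  Join two of them when they have the same \<open>k\<close>. This gives \<open>m \<cdot> m (m - 1) / 2\<close> edges, of order
  \<open>(m\<^sup>2)\<^bsup>3/2\<^esup>\<close>. The sums along edges have the form \<open>(m + 1)\<^sup>k s\<close> with \<open>s \<le> 2 m\<close>, and the power
  cancels in the ratios, which are therefore among the \<open>m\<^sup>2\<close> fractions \<open>i / j\<close>.
\<close>

definition digit_point :: "nat \<Rightarrow> nat \<times> nat \<Rightarrow> real" where
  "digit_point b = (\<lambda>(k, i). real b ^ k * real i)"

definition digit_set :: "nat \<Rightarrow> real set" where
  "digit_set m = digit_point (Suc m) ` ({..<m} \<times> {1..m})"

text \<open>The condition \<open>i < j\<close> lists each unordered pair once, so that edges can be
  counted through their indices.\<close>

definition digit_edge_index :: "nat \<Rightarrow> (nat \<times> nat \<times> nat) set" where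
  "digit_edge_index m = {..<m} \<times> (SIGMA j:{1..m}. {1..<j})"

definition digit_edge :: "nat \<Rightarrow> nat \<times> nat \<times> nat \<Rightarrow> real set" where
  "digit_edge b = (\<lambda>(k, j, i). {digit_point b (k, i), digit_point b (k, j)})"

definition digit_edges :: "nat \<Rightarrow> real set set" where
  "digit_edges m = digit_edge (Suc m) ` digit_edge_index m"

text \<open>If \<open>k < l\<close>, then \<open>b ^ l * j\<close> is at least
  \<open>b ^ Suc k\<close>, which exceeds \<open>b ^ k * i\<close> because \<open>i < b\<close>.
  Used in both directions, this makes the exponents equal.\<close>

lemma digit_power_le:
  fixes b i j k l :: nat
  assumes "i < b" "0 < i" "0 < j" "b ^ k * i = b ^ l * j"
  shows "l \<le> k"
proof (rule ccontr)
  assume "\<not> l \<le> k"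
  then have "b ^ Suc k * j \<le> b ^ l * j"
    using assms(1) by (intro mult_right_mono power_increasing) auto
  also have "\<dots> = b ^ k * i"
    using assms(4) by simp
  finally have "b ^ k * (b * j) \<le> b ^ k * i"
    by (simp add: mult.left_commute mult.assoc)
  then have "b * j \<le> i"
    using assms(1) by simp
  moreover have "b \<le> b * j"
    using assms(3) by simp
  ultimately show False
    using assms(1) by linarith
qed

lemma digit_point_eq_iff:
  assumes "i \<in> {1..<b}" "j \<in> {1..<b}"
  shows "digit_point b (k, i) = digit_point b (l, j) \<longleftrightarrow> k = l \<and> i = j"
proof
  assume "digit_point b (k, i) = digit_point b (l, j)"
  then have "real (b ^ k * i) = real (b ^ l * j)"
    by (simp add: digit_point_def)
  then have eq: "b ^ k * i = b ^ l * j"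
    by (simp only: of_nat_eq_iff)
  then have "k = l"
    using digit_power_le[of i b j k l] digit_power_le[of j b i l k] assms by auto
  then show "k = l \<and> i = j"
    using eq assms by auto
qed auto

lemma finite_digit_set: "finite (digit_set m)"
  by (simp add: digit_set_def)

lemma card_digit_set: "card (digit_set m) = m\<^sup>2"
proof -
  have "inj_on (digit_point (Suc m)) ({..<m} \<times> {1..m})"
    by (auto intro!: inj_onI simp: digit_point_eq_iff)
  then show ?thesis
    by (simp add: digit_set_def card_image power2_eq_square)
qed

lemma zero_notin_digit_set: "0 \<notin> digit_set m"
  by (auto simp: digit_set_def digit_point_def)

lemma digit_edge_subset:
  assumes "e \<in> digit_edges m"
  shows "e \<subseteq> digit_set m"
  using assms
  by (auto simp: digit_edges_def digit_edge_def digit_edge_index_def digit_set_def)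

lemma simple_graph_digit_edges: "simple_graph (digit_set m) (digit_edges m)"
proof -
  have "card e = 2" if "e \<in> digit_edges m" for e
    using that
    by (auto simp: digit_edges_def digit_edge_def digit_edge_index_def card_insert_if
        digit_point_eq_iff)
  then show ?thesis
    by (auto simp: simple_graph_def finite_digit_set dest: digit_edge_subset)
qed

text \<open>Points determine their \<open>(k, i)\<close>, so equal edges have the same indices up to
  a swap of the endpoints, and \<open>i < j\<close> excludes the swap.\<close>

lemma inj_on_digit_edge: "inj_on (digit_edge (Suc m)) (digit_edge_index m)"
  by (auto intro!: inj_onI
      simp: digit_edge_def digit_edge_index_def doubleton_eq_iff digit_point_eq_iff)

lemma card_digit_edges: "real (card (digit_edges m)) = real m * (real m * (real m - 1) / 2)"
proof -
  \<comment> \<open>Here \<open>j - 1\<close> is the size of \<open>{1..<j}\<close>; as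
    \<open>j\<close> starts at 1, the subtraction is never truncated.\<close>
  have "real (\<Sum>j = 1..m. j - 1) = real m * (real m - 1) / 2"
    by (induction m) (auto simp: field_simps)
  moreover have "card (digit_edges m) = m * (\<Sum>j = 1..m. j - 1)"
    unfolding digit_edges_def card_image[OF inj_on_digit_edge]
    by (simp add: digit_edge_index_def card_cartesian_product)
  ultimately show ?thesis
    by (simp only: of_nat_mult)
qed

text \<open>The order of the two digits is forgotten, since \<open>a\<close> may be either endpoint
  of the edge.\<close>

lemma digit_edgeE:
  assumes "{a, b} \<in> digit_edges m"
  obtains k i j where "k < m" "i \<in> {1..m}" "j \<in> {1..m}"
    "a = digit_point (Suc m) (k, i)" "b = digit_point (Suc m) (k, j)"
proof -
  obtain k i j where "k < m" "j \<in> {1..m}" "i \<in> {1..<j}"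
    "{a, b} = {digit_point (Suc m) (k, i), digit_point (Suc m) (k, j)}"
    using assms by (auto simp: digit_edges_def digit_edge_def digit_edge_index_def)
  then show thesis
    using that[of k i j] that[of k j i] by (auto simp: doubleton_eq_iff)
qed

lemma card_graph_sumset_digit_edges: "card (graph_sumset (digit_edges m)) \<le> 2 * m\<^sup>2"
proof -
  have "graph_sumset (digit_edges m) \<subseteq> digit_point (Suc m) ` ({..<m} \<times> {1..2 * m})"
  proof
    fix x assume "x \<in> graph_sumset (digit_edges m)"
    then obtain a b where "x = a + b" "{a, b} \<in> digit_edges m"
      by (auto simp: graph_sumset_def)
    then obtain k i j where "k < m" "i \<in> {1..m}" "j \<in> {1..m}"
      and "x = digit_point (Suc m) (k, i) + digit_point (Suc m) (k, j)"
      by (metis digit_edgeE)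
    \<comment> \<open>The value \<open>i + j\<close> may exceed \<open>m\<close>, so these points
      can coincide; for an upper bound it is enough to count index pairs.\<close>
    then have "x = digit_point (Suc m) (k, i + j)" "(k, i + j) \<in> {..<m} \<times> {1..2 * m}"
      by (auto simp: digit_point_def algebra_simps)
    then show "x \<in> digit_point (Suc m) ` ({..<m} \<times> {1..2 * m})"
      by blast
  qed
  then have "card (graph_sumset (digit_edges m)) \<le> card ({..<m} \<times> {1..2 * m})"
    by (rule surj_card_le[rotated]) simp
  then show ?thesis
    by (simp add: power2_eq_square)
qed

lemma card_graph_ratioset_digit_edges: "card (graph_ratioset (digit_edges m)) \<le> m\<^sup>2"
proof -
  have "graph_ratioset (digit_edges m) \<subseteq> (\<lambda>(i, j). real i / real j) ` ({1..m} \<times> {1..m})"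
  proof
    fix x assume "x \<in> graph_ratioset (digit_edges m)"
    then obtain a b where "x = a / b" "{a, b} \<in> digit_edges m"
      by (auto simp: graph_ratioset_def)
    then obtain k i j where "i \<in> {1..m}" "j \<in> {1..m}"
      and "x = digit_point (Suc m) (k, i) / digit_point (Suc m) (k, j)"
      by (metis digit_edgeE)
    \<comment> \<open>The common power of \<open>Suc m\<close> is nonzero and cancels, so all levels
      \<open>k\<close> share the same ratios.\<close>
    then have "x = real i / real j" "(i, j) \<in> {1..m} \<times> {1..m}"
      by (auto simp: digit_point_def)
    then show "x \<in> (\<lambda>(i, j). real i / real j) ` ({1..m} \<times> {1..m})"
      by (auto intro: rev_image_eqI)
  qed
  then have "card (graph_ratioset (digit_edges m)) \<le> card ({1..m} \<times> {1..m})"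
    by (rule surj_card_le[rotated]) simp
  then show ?thesis
    by (simp add: power2_eq_square)
qed

theorem theorem3p5:
  "\<exists>c C :: real. c > 0 \<and> C > 0 \<and>
     (\<forall>N :: nat. \<exists>n \<ge> N. \<exists>(A :: real set) (E :: real set set).
        finite A \<and> card A = n \<and> simple_graph A E \<and> (\<forall>e\<in>E. 0 \<notin> e) \<and>
        real (card E) \<ge> c * real n powr (3 / 2) \<and>
        real (card (graph_sumset E)) + real (card (graph_ratioset E)) \<le> C * real (card A))"
\<comment> \<open>The constant 3 adds the factor 2 for sums to the factor 1 for ratios. The constant
  1/4 comes from \<open>m - 1\<close> being at least \<open>m / 2\<close>.\<close>
proof (rule exI[of _ "1 / 4"], rule exI[of _ 3], intro conjI allI)
  fix N :: nat
  \<comment> \<open>The summand 2 ensures that \<open>m\<close> is at least 2, as the edge bound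
    requires.\<close>
  define m where "m = N + 2"
  have "N \<le> m\<^sup>2"
    by (simp add: m_def power2_eq_square)
  moreover have "real (card (digit_edges m)) \<ge> 1 / 4 * real (m\<^sup>2) powr (3 / 2)"
  proof -
    have "real m > 0"
      by (simp add: m_def)
    then have "real (m\<^sup>2) powr (3 / 2) = (real m powr 2) powr (3 / 2)"
      by simp
    also have "\<dots> = real m powr 3"
      by (subst powr_powr) simp
    also have "\<dots> = real m ^ 3"
      using \<open>real m > 0\<close> by simp
    finally have "real (m\<^sup>2) powr (3 / 2) = real m ^ 3" .
    moreover have "real m * real m * real m \<le> real m * real m * (2 * (real m - 1))"
      by (intro mult_left_mono) (auto simp: m_def)
    ultimately show ?thesis
      by (simp add: card_digit_edges power3_eq_cube algebra_simps)
  qed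
  moreover have "real (card (graph_sumset (digit_edges m)))
      + real (card (graph_ratioset (digit_edges m))) \<le> 3 * real (card (digit_set m))"
    using card_graph_sumset_digit_edges[of m] card_graph_ratioset_digit_edges[of m]
    unfolding card_digit_set by linarith
  moreover have "\<forall>e\<in>digit_edges m. 0 \<notin> e"
    using digit_edge_subset zero_notin_digit_set by blast
  ultimately show "\<exists>n \<ge> N. \<exists>(A :: real set) (E :: real set set).
        finite A \<and> card A = n \<and> simple_graph A E \<and> (\<forall>e\<in>E. 0 \<notin> e) \<and>
        real (card E) \<ge> 1 / 4 * real n powr (3 / 2) \<and>
        real (card (graph_sumset E)) + real (card (graph_ratioset E)) \<le> 3 * real (card A)"
    using finite_digit_set card_digit_set simple_graph_digit_edges by blast
qed simp_all

end
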